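(* Let $\gamma_1$ be a gauge on $\mathbb{R}^{n_1}$ and let $\gamma_2$ be a gauge on $\mathbb{R}^{n_2}$, and consider the function on $\mathbb{R}^{n_1}\times\mathbb{R}^{n_2}$ $$g(x,y) = \max\{\gamma_1(x), \gamma_2(y)\}.$$ Then $g$ is a gauge on $\mathbb{R}^{n_1}\times\mathbb{R}^{n_2}$, and its polar is given by $$g^\circ(z_1,z_2) = \gamma_1^\circ(z_1) + \gamma_2^\circ(z_2)\qquad\text{for all } (z_1,z_2)\in\mathbb{R}^{n_1}\times\mathbb{R}^{n_2}.$$
   Context: For a convex set $C\subseteq\mathbb{R}^n$ containing the origin, the gauge of $C$ is the function $\gamma(\cdot\mid C):\mathbb{R}^n\to[0,+\infty]$ defined by $$\gamma(x\mid C) = \inf\{\lambda\ge 0 : x\in\lambda C\},$$ with $\inf\emptyset=+\infty$. A function on $\mathbb{R}^n$ is called a gauge if it equals $\gamma(\cdot\mid C)$ for some convex set $C$ containing the origin. The polar of a gauge $\gamma=\gamma(\cdot\mid C)$ is the gauge $\gamma^\circ=\gamma(\cdot\mid C^\circ)$, where $$C^\circ = \{v : \langle v,x\rangle\le 1\ \text{ for all } x\in C\}.$$ The product space $\mathbb{R}^{n_1}\times\mathbb{R}^{n_2}$ carries the inner product $\langle (x,y),(z_1,z_2)\rangle=\langle x,z_1\rangle+\langle y,z_2\rangle$. *)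

theory Defs
  imports "HOL-Analysis.Analysis"
begin

(* Not to be confused with Tagged_Division.gauge.
   The infimum of the empty set is top, i.e. +infinity, in ennreal. *)
definition gauge_of :: "'a::real_vector set \<Rightarrow> 'a \<Rightarrow> ennreal" where
  "gauge_of C x = Inf {ennreal l |l. 0 \<le> l \<and> x \<in> (*\<^sub>R) l ` C}"

definition is_gauge :: "('a::real_vector \<Rightarrow> ennreal) \<Rightarrow> bool" where
  "is_gauge \<gamma> \<longleftrightarrow> (\<exists>C. convex C \<and> 0 \<in> C \<and> \<gamma> = gauge_of C)"

definition polar_set :: "'a::real_inner set \<Rightarrow> 'a set" where
  "polar_set C = {v. \<forall>x\<in>C. v \<bullet> x \<le> 1}"

(* Different convex sets may have the same gauge; the polar depends only on the gauge
   (see polar_gauge_gauge_of below), so THE is well defined on gauges. *)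
definition polar_gauge :: "('a::real_inner \<Rightarrow> ennreal) \<Rightarrow> 'a \<Rightarrow> ennreal" where
  "polar_gauge \<gamma> =
    (THE \<delta>. \<exists>C. convex C \<and> 0 \<in> C \<and> \<gamma> = gauge_of C \<and> \<delta> = gauge_of (polar_set C))"

lemma polar_set_subset_if_gauge_eq:
  fixes C D :: "'a::real_inner set"
  assumes eq: "gauge_of C = gauge_of D"
  shows "polar_set D \<subseteq> polar_set C"
proof
  fix v assume v: "v \<in> polar_set D"
  have "v \<bullet> x \<le> 1" if x: "x \<in> C" for x
  proof (rule field_le_epsilon)
    fix e :: real assume e: "0 < e"
    have "gauge_of C x \<le> ennreal 1"
      unfolding gauge_of_def using x by (intro Inf_lower) force
    also have "\<dots> < ennreal (1 + e)"
      using e by (subst ennreal_less_iff) auto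
    finally have "gauge_of D x < ennreal (1 + e)"
      using eq by simp
    then obtain l y where l: "0 \<le> l" "ennreal l < ennreal (1 + e)" and y: "y \<in> D" "x = l *\<^sub>R y"
      unfolding gauge_of_def Inf_less_iff by auto
    have "v \<bullet> x = l * (v \<bullet> y)"
      by (simp add: y)
    also have "\<dots> \<le> l * 1"
      using v y l by (intro mult_left_mono) (auto simp: polar_set_def)
    also have "\<dots> \<le> 1 + e"
      using l by (simp add: ennreal_less_iff)
    finally show "v \<bullet> x \<le> 1 + e" .
  qed
  then show "v \<in> polar_set C"
    by (simp add: polar_set_def)
qed

lemma polar_gauge_gauge_of:
  fixes C :: "'a::real_inner set"
  assumes "convex C" "0 \<in> C"
  shows "polar_gauge (gauge_of C) = gauge_of (polar_set C)"
  unfolding polar_gauge_def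
proof (rule the_equality)
  fix \<delta> assume "\<exists>D. convex D \<and> 0 \<in> D \<and> gauge_of C = gauge_of D \<and> \<delta> = gauge_of (polar_set D)"
  then obtain D where D: "convex D" "0 \<in> D" "gauge_of C = gauge_of D" "\<delta> = gauge_of (polar_set D)"
    by blast
  then have "polar_set D = polar_set C"
    using polar_set_subset_if_gauge_eq[of D C] polar_set_subset_if_gauge_eq[of C D] by auto
  then show "\<delta> = gauge_of (polar_set C)"
    using D by simp
qed (use assms in blast)

end

theory Submission
  imports Defs
begin

text \<open>
  If \<open>\<gamma>\<^sub>1\<close> and \<open>\<gamma>\<^sub>2\<close> are the gauges of \<open>C\<close> and \<open>D\<close>, then \<open>max (\<gamma>\<^sub>1 x) (\<gamma>\<^sub>2 y)\<close> is the gauge of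
  \<open>C \<times> D\<close> (lemma \<open>gauge_of_Times\<close>): the point \<open>(x, y)\<close> lies in \<open>l (C \<times> D)\<close> iff \<open>x \<in> l C\<close> and
  \<open>y \<in> l D\<close>, and since dilates of a convex set containing the origin grow with \<open>l\<close>, each of these
  two conditions, if it ever holds, holds from some threshold on; both hold from the larger one on.

  The formula for the polar comes from duality: the gauge of the polar set is the support function,
  \<open>z \<mapsto> sup {z \<bullet> x | x \<in> C}\<close> (lemma \<open>gauge_of_polar_set\<close>). On a product the inner product is
  a sum of two terms that can be maximised independently, so the support function of \<open>C \<times> D\<close>
  is the sum of the two support functions (lemma \<open>SUP_inner_Times\<close>).
\<close>

text \<open>
  Shrinking a point of \<open>C\<close> towards the origin stays in \<open>C\<close>, so a dilation factor may always be
  enlarged.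
\<close>
lemma scaleR_image_mono_convex:
  fixes C :: "'a::real_vector set"
  assumes "convex C" "0 \<in> C" "0 \<le> l" "l \<le> m"
  shows "(*\<^sub>R) l ` C \<subseteq> (*\<^sub>R) m ` C"
proof
  fix x assume "x \<in> (*\<^sub>R) l ` C"
  then obtain c where c: "c \<in> C" "x = l *\<^sub>R c" by auto
  show "x \<in> (*\<^sub>R) m ` C"
  proof (cases "m = 0")
    case True
    with c assms show ?thesis by auto
  next
    case False
    then have "0 < m" using assms by simp
    then have "(1 - l / m) *\<^sub>R 0 + (l / m) *\<^sub>R c \<in> C"
      using assms c by (intro convexD) auto
    moreover have "x = m *\<^sub>R ((1 - l / m) *\<^sub>R 0 + (l / m) *\<^sub>R c)"
      using c \<open>0 < m\<close> by simp
    ultimately show ?thesis by blast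
  qed
qed

lemma gauge_of_Times:
  fixes C :: "'a::real_vector set" and D :: "'b::real_vector set"
  assumes C: "convex C" "0 \<in> C" and D: "convex D" "0 \<in> D"
  shows "gauge_of (C \<times> D) (x, y) = max (gauge_of C x) (gauge_of D y)"
proof -
  define A where "A = {l. 0 \<le> l \<and> x \<in> (*\<^sub>R) l ` C}"
  define B where "B = {l. 0 \<le> l \<and> y \<in> (*\<^sub>R) l ` D}"
  have up_A: "m \<in> A" if "l \<in> A" "l \<le> m" for l m
    using scaleR_image_mono_convex[OF C, of l m] that by (auto simp: A_def)
  have up_B: "m \<in> B" if "l \<in> B" "l \<le> m" for l m
    using scaleR_image_mono_convex[OF D, of l m] that by (auto simp: B_def)
  have gauge: "gauge_of C x = Inf (ennreal ` A)" "gauge_of D y = Inf (ennreal ` B)"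
    unfolding gauge_of_def A_def B_def by (auto intro!: arg_cong[where f = Inf])
  have gauge_Times: "gauge_of (C \<times> D) (x, y) = Inf (ennreal ` (A \<inter> B))"
    unfolding gauge_of_def A_def B_def by (rule arg_cong[where f = Inf]) force
  \<comment> \<open>Up-closed sets of reals form a chain, so the intersection is one of the two sets.\<close>
  have "A \<subseteq> B \<or> B \<subseteq> A"
    by (meson linear subsetI up_A up_B)
  then show ?thesis
  proof
    assume "A \<subseteq> B"
    moreover from this have "Inf (ennreal ` B) \<le> Inf (ennreal ` A)"
      by (intro Inf_superset_mono image_mono)
    ultimately show ?thesis
      by (simp add: gauge gauge_Times Int_absorb2 max_absorb1)
  next
    assume "B \<subseteq> A"
    moreover from this have "Inf (ennreal ` A) \<le> Inf (ennreal ` B)"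
      by (intro Inf_superset_mono image_mono)
    ultimately show ?thesis
      by (simp add: gauge gauge_Times Int_absorb1 max_absorb2)
  qed
qed

text \<open>
  For \<open>l > 0\<close>, the vector \<open>z / l\<close> is in the polar set iff \<open>l\<close> bounds all products \<open>z \<bullet> x\<close>, so the
  infimum of these \<open>l\<close> is their supremum. The coercion to extended nonnegative reals turns negative
  products into \<open>0\<close>, which matches the restriction \<open>l \<ge> 0\<close> in the gauge.
\<close>
lemma gauge_of_polar_set:
  fixes C :: "'a::real_inner set"
  shows "gauge_of (polar_set C) z = (SUP x\<in>C. ennreal (z \<bullet> x))"
proof (rule antisym)
  show "(SUP x\<in>C. ennreal (z \<bullet> x)) \<le> gauge_of (polar_set C) z"
    unfolding gauge_of_def
  proof (intro SUP_least Inf_greatest)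
    fix x a
    assume "x \<in> C" "a \<in> {ennreal l |l. 0 \<le> l \<and> z \<in> (*\<^sub>R) l ` polar_set C}"
    then obtain l v where l: "a = ennreal l" "0 \<le> l" "z = l *\<^sub>R v" and "v \<bullet> x \<le> 1"
      by (auto simp: polar_set_def)
    then have "z \<bullet> x \<le> l"
      using mult_left_mono[of "v \<bullet> x" 1 l] by simp
    then show "ennreal (z \<bullet> x) \<le> a"
      using l by (simp add: ennreal_leI)
  qed
next
  show "gauge_of (polar_set C) z \<le> (SUP x\<in>C. ennreal (z \<bullet> x))" (is "_ \<le> ?s")
  proof (cases ?s rule: ennreal_cases)
    case (real s)
    have bound: "z \<bullet> x \<le> s" if "x \<in> C" for x
      using SUP_upper[OF that, of "\<lambda>x. ennreal (z \<bullet> x)"] real by simp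
    \<comment> \<open>The supremum may be \<open>0\<close> with \<open>z \<noteq> 0\<close>, and then it is not itself an admissible factor;
      any larger number is.\<close>
    have "gauge_of (polar_set C) z \<le> ?s + ennreal e" if "0 < e" for e
    proof -
      have pos: "0 < s + e" using real that by simp
      have "inverse (s + e) *\<^sub>R z \<in> polar_set C"
        unfolding polar_set_def
      proof safe
        fix x assume "x \<in> C"
        then have "z \<bullet> x \<le> s + e" using bound that by fastforce
        then show "inverse (s + e) *\<^sub>R z \<bullet> x \<le> 1"
          using pos by (simp add: field_simps)
      qed
      moreover have "z = (s + e) *\<^sub>R (inverse (s + e) *\<^sub>R z)"
        using pos by simp
      ultimately have "z \<in> (*\<^sub>R) (s + e) ` polar_set C"
        by (rule rev_image_eqI)
      then have "ennreal (s + e) \<in> {ennreal l |l. 0 \<le> l \<and> z \<in> (*\<^sub>R) l ` polar_set C}"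
        using less_imp_le[OF pos] by blast
      then have "gauge_of (polar_set C) z \<le> ennreal (s + e)"
        unfolding gauge_of_def by (rule Inf_lower)
      then show ?thesis using real that by simp
    qed
    then show ?thesis by (rule ennreal_le_epsilon)
  next
    case top
    then show ?thesis by (simp only: top_greatest)
  qed
qed

text \<open>
  The origin is what allows the two parts to be maximised separately: where one of the two products
  is negative, it is counted as \<open>0\<close> on the right-hand side, and the left-hand side attains this value
  by replacing that component with \<open>0\<close>.
\<close>
lemma SUP_inner_Times:
  fixes C :: "'a::real_inner set" and D :: "'b::real_inner set"
  assumes "0 \<in> C" "0 \<in> D"
  shows "(SUP p\<in>C \<times> D. ennreal ((z, w) \<bullet> p)) =
    (SUP x\<in>C. ennreal (z \<bullet> x)) + (SUP y\<in>D. ennreal (w \<bullet> y))" (is "?S = ?s + ?t")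
proof (rule antisym)
  show "?S \<le> ?s + ?t"
  proof (rule SUP_least)
    fix p assume "p \<in> C \<times> D"
    then obtain x y where p: "p = (x, y)" "x \<in> C" "y \<in> D" by auto
    have "ennreal ((z, w) \<bullet> p) \<le> ennreal (max 0 (z \<bullet> x) + max 0 (w \<bullet> y))"
      using p by (intro ennreal_leI) simp
    also have "\<dots> = ennreal (z \<bullet> x) + ennreal (w \<bullet> y)"
      by (simp add: ennreal_max_0)
    also have "\<dots> \<le> ?s + ?t"
      using p by (intro add_mono SUP_upper)
    finally show "ennreal ((z, w) \<bullet> p) \<le> ?s + ?t" .
  qed
next
  have "ennreal (z \<bullet> x) + ennreal (w \<bullet> y) \<le> ?S" if "x \<in> C" "y \<in> D" for x y
  proof -
    define x' where "x' = (if z \<bullet> x \<le> 0 then 0 else x)"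
    define y' where "y' = (if w \<bullet> y \<le> 0 then 0 else y)"
    have "ennreal (z \<bullet> x) + ennreal (w \<bullet> y) = ennreal (max 0 (z \<bullet> x) + max 0 (w \<bullet> y))"
      by (simp add: ennreal_max_0)
    also have "max 0 (z \<bullet> x) + max 0 (w \<bullet> y) = (z, w) \<bullet> (x', y')"
      by (simp add: x'_def y'_def)
    also have "ennreal ((z, w) \<bullet> (x', y')) \<le> ?S"
      using that assms by (intro SUP_upper) (auto simp: x'_def y'_def)
    finally show ?thesis .
  qed
  moreover have "?s + ?t = (SUP y\<in>D. SUP x\<in>C. ennreal (z \<bullet> x) + ennreal (w \<bullet> y))"
  proof -
    have "C \<noteq> {}" "D \<noteq> {}" using assms by auto
    then show ?thesis
      by (simp add: ennreal_SUP_add_left ennreal_SUP_add_right)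
  qed
  ultimately show "?s + ?t \<le> ?S"
    by (simp add: SUP_least)
qed

theorem theorem4p1:
  fixes \<gamma>\<^sub>1 :: "real ^ 'n1 \<Rightarrow> ennreal" and \<gamma>\<^sub>2 :: "real ^ 'n2 \<Rightarrow> ennreal"
    and g :: "(real ^ 'n1) \<times> (real ^ 'n2) \<Rightarrow> ennreal"
  assumes "is_gauge \<gamma>\<^sub>1" and "is_gauge \<gamma>\<^sub>2"
    and "\<And>x y. g (x, y) = max (\<gamma>\<^sub>1 x) (\<gamma>\<^sub>2 y)"
  shows "is_gauge g \<and>
    (\<forall>z\<^sub>1 z\<^sub>2. polar_gauge g (z\<^sub>1, z\<^sub>2) = polar_gauge \<gamma>\<^sub>1 z\<^sub>1 + polar_gauge \<gamma>\<^sub>2 z\<^sub>2)"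
proof -
  obtain C where C: "convex C" "0 \<in> C" "\<gamma>\<^sub>1 = gauge_of C"
    using assms(1) by (auto simp: is_gauge_def)
  obtain D where D: "convex D" "0 \<in> D" "\<gamma>\<^sub>2 = gauge_of D"
    using assms(2) by (auto simp: is_gauge_def)
  have CD: "convex (C \<times> D)" "0 \<in> C \<times> D"
    using C D by (auto simp: convex_Times zero_prod_def)
  have g: "g = gauge_of (C \<times> D)"
    using C D by (auto simp: assms(3) gauge_of_Times)
  have "is_gauge g"
    unfolding is_gauge_def using CD g by (intro exI[of _ "C \<times> D"] conjI)
  moreover have "polar_gauge g (z, w) = polar_gauge \<gamma>\<^sub>1 z + polar_gauge \<gamma>\<^sub>2 w" for z w
    unfolding g C(3) D(3) polar_gauge_gauge_of[OF CD]
      polar_gauge_gauge_of[OF C(1,2)] polar_gauge_gauge_of[OF D(1,2)] gauge_of_polar_set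
    by (rule SUP_inner_Times[OF C(2) D(2)])
  ultimately show ?thesis by blast
qed

end
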